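(* Let $n,m\ge1$, let $C\ge1$ with $C\ge(\min(n,m)-1)^2$, and let $\mathbf{A}$ be an $n\times m$ matrix over $\mathbb{K}$. If $\mathbf{A}\in\mathsf{TN}_{2,C}$, then $\mathbf{A}\in\mathsf{TN}$. Similarly, if $\mathbf{A}\in\mathsf{TP}_{2,C}$, then $\mathbf{A}\in\mathsf{TP}$.
   Context: $\mathbb{K}$ is the field of generalized Puiseux series with real coefficients and real exponents: series $f=\sum_{k\ge 0}a_kt^{b_k}$ with $a_k\in\mathbb{R}$ and $(b_k)$ a finite sequence, or a strictly decreasing sequence of reals tending to $-\infty$; it is ordered by declaring a nonzero series positive if the coefficient of its largest exponent is positive. It is a real closed field containing $\mathbb{R}$ as the constant series (so the statement covers real matrices in particular). $\mathsf{TP}$ (resp. $\mathsf{TN}$) is the set of matrices over $\mathbb{K}$ all of whose minors are positive (resp. nonnegative). For $C\ge1$, $\mathsf{TN}_{2,C}$ is the set of matrices $\mathbf{A}$ with nonnegative entries such that $\mathbf{A}_{i,j}\mathbf{A}_{i',j'}\ge C\,\mathbf{A}_{i,j'}\mathbf{A}_{i',j}$ for all $i<i'$ and $j<j'$. $\mathsf{TP}_{2,C}$ is the set of matrices $\mathbf{A}$ with positive entries such that all these inequalities are strict. *)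

theory Defs
  imports Complex_Main "Jordan_Normal_Form.Determinant" "Jordan_Normal_Form.DL_Submatrix"
begin

section \<open>Supports of generalized Puiseux series\<close>

text \<open>
  Some of the coefficients of a series may vanish, so the set of exponents with non-zero
  coefficient is only required to be contained in the range of the exponent sequence.
\<close>

definition puiseux_support :: "real set \<Rightarrow> bool" where
  "puiseux_support S \<longleftrightarrow>
     finite S \<or>
     (\<exists>b :: nat \<Rightarrow> real. strict_antimono_on UNIV b \<and> filterlim b at_bot sequentially \<and> S \<subseteq> range b)"

definition locfin :: "real set \<Rightarrow> bool" where
  "locfin S \<longleftrightarrow> (\<forall>r. finite {b \<in> S. r \<le> b})"

lemma locfin_imp_seq:
  assumes S: "locfin S" and inf: "infinite S"
  shows "\<exists>b :: nat \<Rightarrow> real. strict_antimono_on UNIV b \<and> filterlim b at_bot sequentially \<and> S \<subseteq> range b"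
proof -
  have ex_max: "\<exists>m\<in>T. \<forall>x\<in>T. x \<le> m" if T: "T \<subseteq> S" "T \<noteq> {}" for T
  proof -
    from T(2) obtain t where t: "t \<in> T" by blast
    have fin: "finite {b\<in>T. t \<le> b}"
      by (rule finite_subset[of _ "{b \<in> S. t \<le> b}"]) (use S T in \<open>auto simp: locfin_def\<close>)
    have ne: "{b\<in>T. t \<le> b} \<noteq> {}" using t by auto
    let ?m = "Max {b\<in>T. t \<le> b}"
    have m: "?m \<in> T" "t \<le> ?m" using Max_in[OF fin ne] by auto
    moreover have "x \<le> ?m" if "x \<in> T" for x
    proof (cases "t \<le> x")
      case True
      then show ?thesis using that fin by (intro Max_ge) auto
    next
      case False
      then show ?thesis using m(2) by linarith
    qed
    ultimately show ?thesis by blast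
  qed
  have below: "{x\<in>S. x < y} \<noteq> {}" for y
  proof
    assume "{x\<in>S. x < y} = {}"
    then have "S = {b\<in>S. y \<le> b}" by force
    then show False using S inf unfolding locfin_def by metis
  qed
  have "\<exists>b. (b (0::nat) \<in> S \<and> (0 = (0::nat) \<longrightarrow> (\<forall>x\<in>S. x \<le> b 0))) \<and>
      (\<forall>n. (b (Suc n) \<in> S \<and> (Suc n = 0 \<longrightarrow> (\<forall>x\<in>S. x \<le> b (Suc n)))) \<and>
        (b (Suc n) < b n \<and> (\<forall>x\<in>S. x < b n \<longrightarrow> x \<le> b (Suc n))))"
  proof -
    have "\<exists>f. \<forall>n. (f n \<in> S \<and> (n = (0::nat) \<longrightarrow> (\<forall>x\<in>S. x \<le> f n))) \<and>
            (f (Suc n) < f n \<and> (\<forall>x\<in>S. x < f n \<longrightarrow> x \<le> f (Suc n)))"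
    proof (rule dependent_nat_choice)
      show "\<exists>x. x \<in> S \<and> ((0::nat) = 0 \<longrightarrow> (\<forall>xa\<in>S. xa \<le> x))"
        using ex_max[of S] inf by auto
    next
      fix x and n :: nat
      show "\<exists>y. (y \<in> S \<and> (Suc n = 0 \<longrightarrow> (\<forall>x\<in>S. x \<le> y))) \<and> y < x \<and> (\<forall>xa\<in>S. xa < x \<longrightarrow> xa \<le> y)"
        using ex_max[of "{z\<in>S. z < x}"] below[of x] by auto
    qed
    then show ?thesis by blast
  qed
  then obtain b where bS: "\<And>n. b n \<in> S" and b0: "\<And>x. x \<in> S \<Longrightarrow> x \<le> b 0"
    and dec: "\<And>n. b (Suc n) < b n" and gap: "\<And>n x. x \<in> S \<Longrightarrow> x < b n \<Longrightarrow> x \<le> b (Suc n)"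
    by (metis not0_implies_Suc)
  have anti: "b j < b i" if "i < j" for i j
    using that by (induction rule: strict_inc_induct) (use dec less_trans in blast)+
  have inj: "inj b"
    by (rule injI) (metis anti nat_neq_iff less_irrefl)
  have small: "\<exists>n. b n < r" for r
  proof (rule ccontr)
    assume "\<nexists>n. b n < r"
    then have "range b \<subseteq> {x\<in>S. r \<le> x}" using bS by (auto simp: not_less)
    moreover have "finite {x\<in>S. r \<le> x}" using S by (simp add: locfin_def)
    ultimately have "finite (range b)" by (rule finite_subset)
    then show False using inj by (simp add: finite_image_iff)
  qed
  have "filterlim b at_bot sequentially"
    unfolding filterlim_at_bot eventually_sequentially
  proof
    fix r
    obtain n where "b n < r" using small by blast
    then have "\<forall>k\<ge>n. b k \<le> r" by (metis anti le_neq_implies_less less_imp_le order.trans)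
    then show "\<exists>N. \<forall>n\<ge>N. b n \<le> r" by blast
  qed
  moreover have "S \<subseteq> range b"
  proof
    fix x assume x: "x \<in> S"
    define n where "n = (LEAST n. b n < x)"
    have n: "b n < x" unfolding n_def using small[of x] by (metis LeastI)
    then obtain k where k: "n = Suc k" using b0[OF x] by (cases n) auto
    have "\<not> b k < x" using not_less_Least[of k "\<lambda>n. b n < x"] k unfolding n_def by simp
    moreover have "\<not> x < b k" using gap[OF x, of k] n k by auto
    ultimately have "x = b k" by simp
    then show "x \<in> range b" by blast
  qed
  moreover have "strict_antimono_on UNIV b" by (intro monotone_onI) (use anti in auto)
  ultimately show ?thesis by blast
qed

lemma puiseux_support_iff_locfin: "puiseux_support S \<longleftrightarrow> locfin S"
proof
  assume "puiseux_support S"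
  then consider "finite S" |
    b where "filterlim b at_bot sequentially" "S \<subseteq> range (b :: nat \<Rightarrow> real)"
    unfolding puiseux_support_def by blast
  then show "locfin S"
  proof cases
    case 2
    show ?thesis unfolding locfin_def
    proof
      fix r
      obtain N where N: "\<And>n. n \<ge> N \<Longrightarrow> b n \<le> r - 1"
        using 2(1) unfolding filterlim_at_bot eventually_sequentially by meson
      have "{x\<in>S. r \<le> x} \<subseteq> b ` {..<N}"
      proof
        fix x assume x: "x \<in> {x\<in>S. r \<le> x}"
        then obtain n where n: "x = b n" using 2(2) by blast
        have "n < N" by (rule ccontr) (use N[of n] n x in auto)
        then show "x \<in> b ` {..<N}" using n by blast
      qed
      then show "finite {x\<in>S. r \<le> x}" using finite_surj[of "{..<N}"] by blast
    qed
  qed (simp add: locfin_def)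
next
  assume "locfin S"
  then show "puiseux_support S"
    using locfin_imp_seq[of S] unfolding puiseux_support_def by blast
qed

lemma locfin_subset: "locfin T \<Longrightarrow> S \<subseteq> T \<Longrightarrow> locfin S"
  unfolding locfin_def
proof
  fix r assume "\<forall>r. finite {b \<in> T. r \<le> b}" "S \<subseteq> T"
  then show "finite {b \<in> S. r \<le> b}"
    by (intro finite_subset[of "{b \<in> S. r \<le> b}" "{b \<in> T. r \<le> b}"]) auto
qed

lemma locfin_Un:
  assumes "locfin S" "locfin T"
  shows "locfin (S \<union> T)"
  unfolding locfin_def
proof
  fix r
  have "{b \<in> S \<union> T. r \<le> b} = {b\<in>S. r \<le> b} \<union> {b\<in>T. r \<le> b}" by auto
  then show "finite {b \<in> S \<union> T. r \<le> b}" using assms by (simp add: locfin_def)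
qed

lemma locfin_finite: "finite S \<Longrightarrow> locfin S"
  by (simp add: locfin_def)

lemma locfin_bdd: "locfin S \<Longrightarrow> \<exists>M. \<forall>b\<in>S. b \<le> M"
proof -
  assume S: "locfin S"
  have fin: "finite (insert 0 {b\<in>S. 0 \<le> b})" using S by (simp add: locfin_def)
  have "b \<le> Max (insert 0 {b\<in>S. 0 \<le> b})" if "b \<in> S" for b
  proof (cases "0 \<le> b")
    case True
    then show ?thesis using fin that by (intro Max_ge) auto
  next
    case False
    have "0 \<le> Max (insert 0 {b\<in>S. 0 \<le> b})" using fin by (intro Max_ge) auto
    then show ?thesis using False by linarith
  qed
  then show ?thesis by blast
qed

section \<open>Convolution\<close>

definition supp :: "(real \<Rightarrow> real) \<Rightarrow> real set" where
  "supp f = {b. f b \<noteq> 0}"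

text \<open>
  The Cauchy product.  For two series the index set is finite: both supports are bounded above,
  and each has only finitely many elements above any given real.
\<close>

definition conv :: "(real \<Rightarrow> real) \<Rightarrow> (real \<Rightarrow> real) \<Rightarrow> real \<Rightarrow> real" where
  "conv f g c = (\<Sum>a | f a \<noteq> 0 \<and> g (c - a) \<noteq> 0. f a * g (c - a))"

lemma conv_eq:
  assumes "finite A" "finite B"
    and cov: "\<And>a b. f a \<noteq> 0 \<Longrightarrow> g b \<noteq> 0 \<Longrightarrow> a + b = c \<Longrightarrow> a \<in> A \<and> b \<in> B"
  shows "conv f g c = (\<Sum>a\<in>A. \<Sum>b\<in>B. if a + b = c then f a * g b else 0)"
proof -
  have inner: "(\<Sum>b\<in>B. if a + b = c then f a * g b else 0) = f a * g (c - a)" for a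
  proof -
    have "(\<Sum>b\<in>B. if a + b = c then f a * g b else 0) = (\<Sum>b\<in>B. if b = c - a then f a * g b else 0)"
      by (rule sum.cong) auto
    also have "\<dots> = (if c - a \<in> B then f a * g (c - a) else 0)"
      using assms(2) by (simp add: sum.delta)
    also have "\<dots> = f a * g (c - a)"
      using cov[of a "c - a"] by auto
    finally show ?thesis .
  qed
  have "conv f g c = (\<Sum>a\<in>A. f a * g (c - a))"
    unfolding conv_def
  proof (rule sum.mono_neutral_left)
    show "{a. f a \<noteq> 0 \<and> g (c - a) \<noteq> 0} \<subseteq> A" using cov[of _ "c - _"] by force
  qed (use assms(1) in auto)
  then show ?thesis unfolding inner .
qed

lemma conv_nz:
  assumes "conv f g c \<noteq> 0"
  shows "\<exists>a b. f a \<noteq> 0 \<and> g b \<noteq> 0 \<and> a + b = c"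
proof -
  have "{a. f a \<noteq> 0 \<and> g (c - a) \<noteq> 0} \<noteq> {}"
    using assms unfolding conv_def by (metis sum.empty)
  then obtain a where "f a \<noteq> 0" "g (c - a) \<noteq> 0" by blast
  then show ?thesis by (intro exI[of _ a] exI[of _ "c - a"]) simp
qed

lemma locfin_supp_add: "locfin (supp f) \<Longrightarrow> locfin (supp g) \<Longrightarrow> locfin (supp (\<lambda>b. f b + g b))"
  by (rule locfin_subset[OF locfin_Un[of "supp f" "supp g"]]) (auto simp: supp_def)

lemma locfin_supp_diff: "locfin (supp f) \<Longrightarrow> locfin (supp g) \<Longrightarrow> locfin (supp (\<lambda>b. f b - g b))"
  by (rule locfin_subset[OF locfin_Un[of "supp f" "supp g"]]) (auto simp: supp_def)

lemma locfin_supp_scale: "locfin (supp f) \<Longrightarrow> locfin (supp (\<lambda>b. r * f b))"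
  by (rule locfin_subset[of "supp f"]) (auto simp: supp_def)

definition cut_supp :: "(real \<Rightarrow> real) \<Rightarrow> real \<Rightarrow> real set" where
  "cut_supp f r = {b \<in> supp f. r \<le> b}"

lemma finite_cut_supp: "locfin (supp f) \<Longrightarrow> finite (cut_supp f r)"
  by (simp add: locfin_def cut_supp_def)

lemma in_cut_supp: "b \<in> cut_supp f r \<longleftrightarrow> f b \<noteq> 0 \<and> r \<le> b"
  by (simp add: cut_supp_def supp_def)

lemma bdd_supp: "locfin (supp f) \<Longrightarrow> \<exists>M. \<forall>b. f b \<noteq> 0 \<longrightarrow> b \<le> M"
  using locfin_bdd[of "supp f"] by (auto simp: supp_def)

lemma locfin_conv:
  assumes f: "locfin (supp f)" and g: "locfin (supp g)"
  shows "locfin (supp (conv f g))"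
  unfolding locfin_def
proof
  fix r
  obtain M where M: "\<And>b. f b \<noteq> 0 \<Longrightarrow> b \<le> M" using bdd_supp[OF f] by blast
  obtain N where N: "\<And>b. g b \<noteq> 0 \<Longrightarrow> b \<le> N" using bdd_supp[OF g] by blast
  have "{b \<in> supp (conv f g). r \<le> b} \<subseteq> (\<lambda>(a,b). a + b) ` (cut_supp f (r - N) \<times> cut_supp g (r - M))"
  proof
    fix c assume c: "c \<in> {b \<in> supp (conv f g). r \<le> b}"
    then obtain a b where ab: "f a \<noteq> 0" "g b \<noteq> 0" "a + b = c"
      using conv_nz[of f g c] by (auto simp: supp_def)
    have "a \<in> cut_supp f (r - N)" "b \<in> cut_supp g (r - M)"
      using ab c M[of a] N[of b] by (auto simp: in_cut_supp)
    then show "c \<in> (\<lambda>(a,b). a + b) ` (cut_supp f (r - N) \<times> cut_supp g (r - M))" using ab(3) by force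
  qed
  then show "finite {b \<in> supp (conv f g). r \<le> b}"
    using finite_cut_supp[OF f] finite_cut_supp[OF g] by (meson finite_SigmaI finite_surj)
qed

lemma conv_commute:
  assumes f: "locfin (supp f)" and g: "locfin (supp g)"
  shows "conv f g = conv g f"
proof
  fix c
  obtain M where M: "\<And>b. f b \<noteq> 0 \<Longrightarrow> b \<le> M" using bdd_supp[OF f] by blast
  obtain N where N: "\<And>b. g b \<noteq> 0 \<Longrightarrow> b \<le> N" using bdd_supp[OF g] by blast
  let ?A = "cut_supp f (c - N)" and ?B = "cut_supp g (c - M)"
  have fin: "finite ?A" "finite ?B" using finite_cut_supp f g by auto
  have cov: "a \<in> ?A \<and> b \<in> ?B" if "f a \<noteq> 0" "g b \<noteq> 0" "a + b = c" for a b
    using that M[of a] N[of b] by (auto simp: in_cut_supp)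
  have "conv f g c = (\<Sum>a\<in>?A. \<Sum>b\<in>?B. if a + b = c then f a * g b else 0)"
    by (rule conv_eq) (use fin cov in auto)
  also have "\<dots> = (\<Sum>b\<in>?B. \<Sum>a\<in>?A. if b + a = c then g b * f a else 0)"
    by (subst sum.swap) (auto intro!: sum.cong simp: add.commute)
  also have "\<dots> = conv g f c"
    by (rule conv_eq[symmetric]) (use fin cov in \<open>auto simp: add.commute\<close>)
  finally show "conv f g c = conv g f c" .
qed

lemma conv_triple:
  assumes f: "locfin (supp f)" and g: "locfin (supp g)" and h: "locfin (supp h)"
    and Mf: "\<And>b. f b \<noteq> 0 \<Longrightarrow> b \<le> M" and Mg: "\<And>b. g b \<noteq> 0 \<Longrightarrow> b \<le> M" and Mh: "\<And>b. h b \<noteq> 0 \<Longrightarrow> b \<le> M"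
  shows "conv (conv f g) h d = (\<Sum>a\<in>cut_supp f (d - 2*M). \<Sum>b\<in>cut_supp g (d - 2*M). \<Sum>z\<in>cut_supp h (d - 2*M).
           if a + b + z = d then f a * g b * h z else 0)"
proof -
  let ?A = "cut_supp f (d - 2*M)" and ?B = "cut_supp g (d - 2*M)" and ?C = "cut_supp h (d - 2*M)"
  have fin: "finite ?A" "finite ?B" "finite ?C" using finite_cut_supp f g h by auto
  define X where "X = {x \<in> (\<lambda>(a,b). a + b) ` (?A \<times> ?B). d - M \<le> x}"
  have finX: "finite X" unfolding X_def using fin by simp
  have inX: "a + b \<in> X \<longleftrightarrow> d - M \<le> a + b" if "a \<in> ?A" "b \<in> ?B" for a b
    unfolding X_def using that by force
  have "conv (conv f g) h d = (\<Sum>x\<in>X. \<Sum>z\<in>?C. if x + z = d then conv f g x * h z else 0)"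
  proof (rule conv_eq)
    fix x z assume xz: "conv f g x \<noteq> 0" "h z \<noteq> 0" "x + z = d"
    obtain a b where ab: "f a \<noteq> 0" "g b \<noteq> 0" "a + b = x" using conv_nz[OF xz(1)] by blast
    have bnd: "a \<le> M" "b \<le> M" "z \<le> M" using Mf Mg Mh ab xz by auto
    have "a \<in> ?A" "b \<in> ?B" using ab bnd xz by (auto simp: in_cut_supp)
    moreover have "d - M \<le> a + b" using ab xz bnd by linarith
    ultimately have "x \<in> X" using inX ab(3) by blast
    moreover have "z \<in> ?C" using ab bnd xz by (auto simp: in_cut_supp)
    ultimately show "x \<in> X \<and> z \<in> ?C" by blast
  qed (use fin finX in auto)
  also have "\<dots> = (\<Sum>x\<in>X. \<Sum>z\<in>?C. \<Sum>a\<in>?A. \<Sum>b\<in>?B. if a + b = x then (if x + z = d then f a * g b * h z else 0) else 0)"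
  proof (intro sum.cong refl)
    fix x z assume x: "x \<in> X"
    have "conv f g x = (\<Sum>a\<in>?A. \<Sum>b\<in>?B. if a + b = x then f a * g b else 0)"
    proof (rule conv_eq)
      fix a b assume ab: "f a \<noteq> 0" "g b \<noteq> 0" "a + b = x"
      have "d - M \<le> x" using x unfolding X_def by simp
      then show "a \<in> ?A \<and> b \<in> ?B" using ab Mf[of a] Mg[of b] by (auto simp: in_cut_supp)
    qed (use fin in auto)
    then have e: "conv f g x * h z = (\<Sum>a\<in>?A. \<Sum>b\<in>?B. if a + b = x then f a * g b * h z else 0)"
      by (simp add: sum_distrib_right if_distrib[of "\<lambda>u. u * h z"] cong: if_cong)
    show "(if x + z = d then conv f g x * h z else 0) =
        (\<Sum>a\<in>?A. \<Sum>b\<in>?B. if a + b = x then (if x + z = d then f a * g b * h z else 0) else 0)"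
      by (cases "x + z = d") (simp_all add: e cong: if_cong)
  qed
  also have "\<dots> = (\<Sum>x\<in>X. \<Sum>a\<in>?A. \<Sum>z\<in>?C. \<Sum>b\<in>?B. if a + b = x then (if x + z = d then f a * g b * h z else 0) else 0)"
    by (rule sum.cong[OF refl]) (rule sum.swap)
  also have "\<dots> = (\<Sum>x\<in>X. \<Sum>a\<in>?A. \<Sum>b\<in>?B. \<Sum>z\<in>?C. if a + b = x then (if x + z = d then f a * g b * h z else 0) else 0)"
    by (rule sum.cong[OF refl], rule sum.cong[OF refl]) (rule sum.swap)
  also have "\<dots> = (\<Sum>a\<in>?A. \<Sum>x\<in>X. \<Sum>b\<in>?B. \<Sum>z\<in>?C. if a + b = x then (if x + z = d then f a * g b * h z else 0) else 0)"
    by (rule sum.swap)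
  also have "\<dots> = (\<Sum>a\<in>?A. \<Sum>b\<in>?B. \<Sum>x\<in>X. \<Sum>z\<in>?C. if a + b = x then (if x + z = d then f a * g b * h z else 0) else 0)"
    by (rule sum.cong[OF refl]) (rule sum.swap)
  also have "\<dots> = (\<Sum>a\<in>?A. \<Sum>b\<in>?B. \<Sum>z\<in>?C. \<Sum>x\<in>X. if a + b = x then (if x + z = d then f a * g b * h z else 0) else 0)"
    by (rule sum.cong[OF refl], rule sum.cong[OF refl]) (rule sum.swap)
  also have "\<dots> = (\<Sum>a\<in>?A. \<Sum>b\<in>?B. \<Sum>z\<in>?C. if a + b + z = d then f a * g b * h z else 0)"
  proof (intro sum.cong refl)
    fix a b z assume abz: "a \<in> ?A" "b \<in> ?B" "z \<in> ?C"
    have "(\<Sum>x\<in>X. if a + b = x then (if x + z = d then f a * g b * h z else 0) else 0)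
        = (if a + b \<in> X then (if a + b + z = d then f a * g b * h z else 0) else 0)"
      using finX by (simp add: sum.delta')
    moreover have "a + b \<in> X" if "a + b + z = d"
      using inX[OF abz(1,2)] abz(3) Mh[of z] that by (auto simp: in_cut_supp)
    ultimately show "(\<Sum>x\<in>X. if a + b = x then (if x + z = d then f a * g b * h z else 0) else 0)
        = (if a + b + z = d then f a * g b * h z else 0)" by auto
  qed
  finally show ?thesis .
qed

lemma conv_assoc:
  assumes f: "locfin (supp f)" and g: "locfin (supp g)" and h: "locfin (supp h)"
  shows "conv (conv f g) h = conv f (conv g h)"
proof
  fix d
  obtain M1 where M1: "\<And>b. f b \<noteq> 0 \<Longrightarrow> b \<le> M1" using bdd_supp[OF f] by blast
  obtain M2 where M2: "\<And>b. g b \<noteq> 0 \<Longrightarrow> b \<le> M2" using bdd_supp[OF g] by blast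
  obtain M3 where M3: "\<And>b. h b \<noteq> 0 \<Longrightarrow> b \<le> M3" using bdd_supp[OF h] by blast
  define M where "M = max M1 (max M2 M3)"
  have Mf: "\<And>b. f b \<noteq> 0 \<Longrightarrow> b \<le> M" and Mg: "\<And>b. g b \<noteq> 0 \<Longrightarrow> b \<le> M" and Mh: "\<And>b. h b \<noteq> 0 \<Longrightarrow> b \<le> M"
    unfolding M_def using M1 M2 M3 by (simp_all add: le_max_iff_disj)
  let ?A = "cut_supp f (d - 2*M)" and ?B = "cut_supp g (d - 2*M)" and ?C = "cut_supp h (d - 2*M)"
  have "conv f (conv g h) d = conv (conv g h) f d"
    by (simp add: conv_commute[OF f locfin_conv[OF g h]])
  also have "\<dots> = (\<Sum>b\<in>?B. \<Sum>z\<in>?C. \<Sum>a\<in>?A. if b + z + a = d then g b * h z * f a else 0)"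
    by (rule conv_triple) (use f g h Mf Mg Mh in auto)
  also have "\<dots> = (\<Sum>b\<in>?B. \<Sum>a\<in>?A. \<Sum>z\<in>?C. if b + z + a = d then g b * h z * f a else 0)"
    by (rule sum.cong[OF refl]) (rule sum.swap)
  also have "\<dots> = (\<Sum>a\<in>?A. \<Sum>b\<in>?B. \<Sum>z\<in>?C. if b + z + a = d then g b * h z * f a else 0)"
    by (rule sum.swap)
  also have "\<dots> = (\<Sum>a\<in>?A. \<Sum>b\<in>?B. \<Sum>z\<in>?C. if a + b + z = d then f a * g b * h z else 0)"
    by (intro sum.cong refl if_cong) auto
  also have "\<dots> = conv (conv f g) h d"
    by (rule conv_triple[symmetric]) (use f g h Mf Mg Mh in auto)
  finally show "conv (conv f g) h d = conv f (conv g h) d" by simp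
qed

lemma conv_add_left:
  assumes f: "locfin (supp f)" and g: "locfin (supp g)" and h: "locfin (supp h)"
  shows "conv (\<lambda>x. f x + g x) h = (\<lambda>x. conv f h x + conv g h x)"
proof
  fix c
  obtain M where M: "\<And>b. h b \<noteq> 0 \<Longrightarrow> b \<le> M" using bdd_supp[OF h] by blast
  let ?A = "cut_supp f (c - M) \<union> cut_supp g (c - M)" 
  have finA: "finite ?A" using finite_cut_supp f g by auto
  let ?B = "(\<lambda>a. c - a) ` ?A"
  have finB: "finite ?B" using finA by auto
  have cov: "a \<in> ?A \<and> b \<in> ?B" if "f a \<noteq> 0 \<or> g a \<noteq> 0" "h b \<noteq> 0" "a + b = c" for a b
  proof -
    have "a \<in> ?A" using that M[of b] by (auto simp: in_cut_supp)
    moreover have "b = c - a" using that by simp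
    ultimately show ?thesis by blast
  qed
  have "conv (\<lambda>x. f x + g x) h c = (\<Sum>a\<in>?A. \<Sum>b\<in>?B. if a + b = c then (f a + g a) * h b else 0)"
    by (rule conv_eq) (use finA finB in simp, use finA finB in simp, rule cov, auto)
  moreover have "conv f h c = (\<Sum>a\<in>?A. \<Sum>b\<in>?B. if a + b = c then f a * h b else 0)"
    by (rule conv_eq) (use finA finB in simp, use finA finB in simp, rule cov, auto)
  moreover have "conv g h c = (\<Sum>a\<in>?A. \<Sum>b\<in>?B. if a + b = c then g a * h b else 0)"
    by (rule conv_eq) (use finA finB in simp, use finA finB in simp, rule cov, auto)
  ultimately show "conv (\<lambda>x. f x + g x) h c = conv f h c + conv g h c"
    by (simp only: sum.distrib[symmetric])
       (auto intro!: sum.cong simp: distrib_right)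
qed

lemma conv_single: "conv (\<lambda>x. if x = p then r else 0) g c = r * g (c - p)"
proof -
  have "conv (\<lambda>x. if x = p then r else 0) g c =
     (\<Sum>a\<in>{p}. \<Sum>b\<in>{c-p}. if a + b = c then (if a = p then r else 0) * g b else 0)"
    by (rule conv_eq) (auto split: if_splits)
  then show ?thesis by simp
qed

lemma conv_top:
  assumes "\<And>b. p < b \<Longrightarrow> f b = 0" "\<And>b. q < b \<Longrightarrow> g b = 0"
  shows "conv f g (p + q) = f p * g q"
    and "p + q < c \<Longrightarrow> conv f g c = 0"
proof -
  have "conv f g (p + q) = (\<Sum>a\<in>{p}. \<Sum>b\<in>{q}. if a + b = p + q then f a * g b else 0)"
  proof (rule conv_eq)
    fix a b assume ab: "f a \<noteq> 0" "g b \<noteq> 0" "a + b = p + q"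
    have "a \<le> p" "b \<le> q" using assms(1)[of a] assms(2)[of b] ab by fastforce+
    then show "a \<in> {p} \<and> b \<in> {q}" using ab(3) by auto
  qed auto
  then show "conv f g (p + q) = f p * g q" by simp
  assume c: "p + q < c"
  show "conv f g c = 0"
  proof (rule ccontr)
    assume "conv f g c \<noteq> 0"
    then obtain a b where ab: "f a \<noteq> 0" "g b \<noteq> 0" "a + b = c" using conv_nz by blast
    have "a \<le> p" "b \<le> q" using assms(1)[of a] assms(2)[of b] ab by fastforce+
    then show False using ab(3) c by auto
  qed
qed

section \<open>The ordered field of generalized Puiseux series\<close>

text \<open>A series is represented by its coefficient function, which sends an exponent
  \<open>b\<close> to the coefficient of \<open>t\<^sup>b\<close>.\<close>

typedef gpuiseux = "{f :: real \<Rightarrow> real. puiseux_support {b. f b \<noteq> 0}}"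
  morphisms gcoeff Abs_gpuiseux
  by (rule exI[of _ "\<lambda>_. 0"]) (simp add: puiseux_support_def)

setup_lifting type_definition_gpuiseux

lemma gpuiseux_eqI: "(\<And>b. gcoeff f b = gcoeff g b) \<Longrightarrow> f = g"
  by (metis ext gcoeff_inject)

lemma locfin_gcoeff: "locfin (supp (gcoeff f))"
  using gcoeff[of f] by (simp add: puiseux_support_iff_locfin supp_def)

lemma psupp: "puiseux_support {b. f b \<noteq> 0} \<longleftrightarrow> locfin (supp f)"
  by (simp add: puiseux_support_iff_locfin supp_def)

lift_definition gmonom :: "real \<Rightarrow> real \<Rightarrow> gpuiseux" is "\<lambda>r p x. if x = p then r else 0"
  unfolding psupp by (rule locfin_finite) (auto simp: supp_def)

instantiation gpuiseux :: comm_ring_1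
begin

lift_definition zero_gpuiseux :: gpuiseux is "\<lambda>_. 0"
  by (simp add: puiseux_support_def)

lift_definition one_gpuiseux :: gpuiseux is "\<lambda>b. if b = 0 then 1 else 0"
  by (simp add: puiseux_support_def)

lift_definition plus_gpuiseux :: "gpuiseux \<Rightarrow> gpuiseux \<Rightarrow> gpuiseux" is "\<lambda>f g b. f b + g b"
  unfolding psupp by (rule locfin_supp_add)

lift_definition uminus_gpuiseux :: "gpuiseux \<Rightarrow> gpuiseux" is "\<lambda>f b. - f b"
  by simp

lift_definition minus_gpuiseux :: "gpuiseux \<Rightarrow> gpuiseux \<Rightarrow> gpuiseux" is "\<lambda>f g b. f b - g b"
  unfolding psupp by (rule locfin_supp_diff)

lift_definition times_gpuiseux :: "gpuiseux \<Rightarrow> gpuiseux \<Rightarrow> gpuiseux" is conv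
  unfolding psupp by (rule locfin_conv)

instance
proof
  fix a b c :: gpuiseux
  show "a * b * c = a * (b * c)"
    by transfer (rule conv_assoc; simp add: psupp)
  show "a * b = b * a"
    by transfer (rule conv_commute; simp add: psupp)
  show "1 * a = a"
    by transfer (rule ext, simp add: conv_single)
  show "(a + b) * c = a * c + b * c"
    by transfer (rule conv_add_left; simp add: psupp)
  show "(0::gpuiseux) \<noteq> 1"
    by transfer (metis zero_neq_one)
qed (transfer; simp add: fun_eq_iff)+

end

lemma gcoeff_top:
  assumes "\<And>b. p < b \<Longrightarrow> gcoeff f b = 0" "\<And>b. q < b \<Longrightarrow> gcoeff g b = 0"
  shows "gcoeff (f * g) (p + q) = gcoeff f p * gcoeff g q"
    and "p + q < c \<Longrightarrow> gcoeff (f * g) c = 0"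
  unfolding times_gpuiseux.rep_eq
  using conv_top(1)[of p "gcoeff f" q "gcoeff g", OF assms]
    conv_top(2)[of p "gcoeff f" q "gcoeff g" c, OF assms] by auto

lemma ex_lead:
  assumes "f \<noteq> 0"
  shows "\<exists>p. gcoeff f p \<noteq> 0 \<and> (\<forall>b>p. gcoeff f b = 0)"
proof -
  obtain r where r: "gcoeff f r \<noteq> 0"
    using assms gpuiseux_eqI[of f 0] by (auto simp: zero_gpuiseux.rep_eq)
  have fin: "finite (cut_supp (gcoeff f) r)" by (rule finite_cut_supp[OF locfin_gcoeff])
  have rin: "r \<in> cut_supp (gcoeff f) r" using r by (simp add: in_cut_supp)
  define p where "p = Max (cut_supp (gcoeff f) r)"
  have p: "p \<in> cut_supp (gcoeff f) r" unfolding p_def using fin rin by (intro Max_in) auto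
  have "gcoeff f b = 0" if "p < b" for b
  proof (rule ccontr)
    assume "gcoeff f b \<noteq> 0"
    then have "b \<in> cut_supp (gcoeff f) r" using that p by (auto simp: in_cut_supp)
    then have "b \<le> p" unfolding p_def using fin by (rule Max_ge[rotated])
    then show False using that by simp
  qed
  then show ?thesis using p by (auto simp: in_cut_supp)
qed

lemma gmonom_mult: "gcoeff (gmonom r p * g) c = r * gcoeff g (c - p)"
  by transfer (rule conv_single)

lemma gpuiseux_inverse_near_1:
  assumes u: "\<And>b. e < b \<Longrightarrow> gcoeff u b = 0" and e: "e < 0"
  shows "\<exists>g. (1 - u) * g = 1"
proof -
  define S where "S = (\<lambda>N. \<Sum>k\<le>N. u ^ k)"
  have pow: "gcoeff (u ^ k) c = 0" if "real k * e < c" for k c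
    using that
  proof (induction k arbitrary: c)
    case 0
    then show ?case by (simp add: one_gpuiseux.rep_eq)
  next
    case (Suc k)
    have "gcoeff (u * u ^ k) c = 0"
      by (rule gcoeff_top(2)[of e u "real k * e" "u ^ k"])
         (use u Suc in \<open>auto simp: algebra_simps\<close>)
    then show ?case by simp
  qed
  define N where "N = (\<lambda>r. nat \<lceil>r / e\<rceil>)"
  have N: "real k * e < r" if "N r < k" for r k
  proof -
    have "r / e < real k" using that unfolding N_def by linarith
    then show ?thesis using e by (simp add: divide_less_eq)
  qed
  have N_mono: "N b \<le> N r" if "r \<le> b" for r b
    unfolding N_def using that e by (intro nat_mono ceiling_mono) (simp add: divide_right_mono_neg)
  have stab: "gcoeff (S n) b = gcoeff (S (N b)) b" if "N b \<le> n" for n b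
    using that
  proof (induction n rule: dec_induct)
    case (step n)
    have "gcoeff (u ^ Suc n) b = 0" by (rule pow, rule N) (use step in simp)
    then show ?case using step unfolding S_def by (simp add: plus_gpuiseux.rep_eq)
  qed simp
  define g0 where "g0 = (\<lambda>b. gcoeff (S (N b)) b)"
  have g0: "g0 b = gcoeff (S n) b" if "N r \<le> n" "r \<le> b" for r b n
    unfolding g0_def using stab[of b n] N_mono[of r b] that by simp
  have "locfin (supp g0)"
    unfolding locfin_def
  proof
    fix r
    have "{b \<in> supp g0. r \<le> b} \<subseteq> cut_supp (gcoeff (S (N r))) r"
      using g0[of r "N r"] by (auto simp: in_cut_supp supp_def)
    then show "finite {b \<in> supp g0. r \<le> b}"
      using finite_cut_supp[OF locfin_gcoeff] finite_subset by blast
  qed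
  then obtain g where g: "gcoeff g = g0"
    using Abs_gpuiseux_inverse[of g0] by (auto simp: psupp)
  have "(1 - u) * g = 1"
  proof (rule gpuiseux_eqI)
    fix c
    define n where "n = N (min c (c - 1))"
    have v: "gcoeff (1 - u) a = 0" if "0 < a" for a
      using u[of a] that e by (simp add: minus_gpuiseux.rep_eq one_gpuiseux.rep_eq)
    have "gcoeff ((1 - u) * g) c = gcoeff ((1 - u) * S n) c"
      unfolding times_gpuiseux.rep_eq conv_def
    proof (rule sum.cong)
      have eq: "gcoeff g (c - a) = gcoeff (S n) (c - a)" if "gcoeff (1 - u) a \<noteq> 0" for a
      proof -
        have "a \<le> 0" using v[of a] that by force
        then show ?thesis unfolding g n_def by (intro g0[OF order_refl]) auto
      qed
      then show "{a. gcoeff (1 - u) a \<noteq> 0 \<and> gcoeff g (c - a) \<noteq> 0} =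
        {a. gcoeff (1 - u) a \<noteq> 0 \<and> gcoeff (S n) (c - a) \<noteq> 0}" by auto
      show "gcoeff (1 - u) a * gcoeff g (c - a) = gcoeff (1 - u) a * gcoeff (S n) (c - a)"
        if "a \<in> {a. gcoeff (1 - u) a \<noteq> 0 \<and> gcoeff (S n) (c - a) \<noteq> 0}" for a
        using that eq by simp
    qed
    also have "(1 - u) * S n = 1 - u ^ Suc n"
      unfolding S_def by (rule sum_gp_basic)
    also have "gcoeff (1 - u ^ Suc n) c = gcoeff 1 c"
    proof -
      have "real (Suc n) * e < min c (c - 1)" by (rule N) (simp add: n_def)
      then show ?thesis using pow[of "Suc n" c] by (simp add: minus_gpuiseux.rep_eq)
    qed
    finally show "gcoeff ((1 - u) * g) c = gcoeff 1 c" .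
  qed
  then show ?thesis by blast
qed

lemma gpuiseux_ex_inverse:
  fixes f :: gpuiseux
  assumes "f \<noteq> 0"
  shows "\<exists>g. f * g = 1"
proof -
  obtain p where p: "gcoeff f p \<noteq> 0" "\<And>b. p < b \<Longrightarrow> gcoeff f b = 0"
    using ex_lead[OF assms] by blast
  define m where "m = gmonom (1 / gcoeff f p) (- p)"
  define u where "u = 1 - m * f"
  have u0: "gcoeff u b = 0" if "0 \<le> b" for b
    unfolding u_def m_def using p that
    by (cases "b = 0") (auto simp: minus_gpuiseux.rep_eq one_gpuiseux.rep_eq gmonom_mult)
  define e where "e = Max (insert (- 1) (cut_supp (gcoeff u) (- 1)))"
  have fin: "finite (insert (- 1) (cut_supp (gcoeff u) (- 1)))"
    using finite_cut_supp[OF locfin_gcoeff] by simp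
  have "e < 0"
    unfolding e_def using fin u0 by (subst Max_less_iff) (auto simp: in_cut_supp, meson not_le)
  moreover have "gcoeff u b = 0" if "e < b" for b
  proof (rule ccontr)
    assume nz: "gcoeff u b \<noteq> 0"
    have "- 1 \<le> e" unfolding e_def using fin by (intro Max_ge) auto
    then have "b \<in> insert (- 1) (cut_supp (gcoeff u) (- 1))" using nz that by (auto simp: in_cut_supp)
    then have "b \<le> e" unfolding e_def using fin by (intro Max_ge) auto
    then show False using that by simp
  qed
  ultimately obtain g where "(1 - u) * g = 1" using gpuiseux_inverse_near_1[of e u] by blast
  then have "f * (m * g) = 1" unfolding u_def by (simp add: ac_simps)
  then show ?thesis by blast
qed

instantiation gpuiseux :: field
begin

definition inverse_gpuiseux :: "gpuiseux \<Rightarrow> gpuiseux" where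
  "inverse_gpuiseux f = (if f = 0 then 0 else (SOME g. f * g = 1))"

definition divide_gpuiseux :: "gpuiseux \<Rightarrow> gpuiseux \<Rightarrow> gpuiseux" where
  "divide_gpuiseux f g = f * inverse g"

instance
proof
  fix a :: gpuiseux
  assume "a \<noteq> 0"
  then have "a * inverse a = 1"
    unfolding inverse_gpuiseux_def using someI_ex[OF gpuiseux_ex_inverse[of a]] by simp
  then show "inverse a * a = 1" by (simp add: mult.commute)
qed (simp_all add: inverse_gpuiseux_def divide_gpuiseux_def)

end

text \<open>A non-zero series is positive if the coefficient of its largest exponent is.\<close>

definition gpos :: "gpuiseux \<Rightarrow> bool" where
  "gpos f \<longleftrightarrow> (\<exists>b. gcoeff f b > 0 \<and> (\<forall>c>b. gcoeff f c = 0))"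

lemma gpos_add: "gpos f \<Longrightarrow> gpos g \<Longrightarrow> gpos (f + g)"
proof -
  assume "gpos f" "gpos g"
  then obtain p q where p: "gcoeff f p > 0" "\<And>c. c > p \<Longrightarrow> gcoeff f c = 0"
    and q: "gcoeff g q > 0" "\<And>c. c > q \<Longrightarrow> gcoeff g c = 0"
    unfolding gpos_def by blast
  have "gcoeff (f + g) (max p q) > 0"
    using p q by (cases p q rule: linorder_cases) (auto simp: plus_gpuiseux.rep_eq max_def)
  moreover have "gcoeff (f + g) c = 0" if "c > max p q" for c
    using p q that by (simp add: plus_gpuiseux.rep_eq)
  ultimately show ?thesis unfolding gpos_def by blast
qed

lemma gpos_mult: "gpos f \<Longrightarrow> gpos g \<Longrightarrow> gpos (f * g)"
proof -
  assume "gpos f" "gpos g"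
  then obtain p q where p: "gcoeff f p > 0" "\<And>c. c > p \<Longrightarrow> gcoeff f c = 0"
    and q: "gcoeff g q > 0" "\<And>c. c > q \<Longrightarrow> gcoeff g c = 0"
    unfolding gpos_def by blast
  then show ?thesis
    unfolding gpos_def using gcoeff_top[of p f q g] by (intro exI[of _ "p + q"]) auto
qed

lemma gpos_not_zero: "\<not> gpos 0"
  by (simp add: gpos_def zero_gpuiseux.rep_eq)

lemma gpos_total: "f = 0 \<or> gpos f \<or> gpos (- f)"
  using ex_lead[of f] unfolding gpos_def uminus_gpuiseux.rep_eq by force

instantiation gpuiseux :: linordered_field
begin

definition less_gpuiseux :: "gpuiseux \<Rightarrow> gpuiseux \<Rightarrow> bool" where
  "f < g \<longleftrightarrow> gpos (g - f)"

definition less_eq_gpuiseux :: "gpuiseux \<Rightarrow> gpuiseux \<Rightarrow> bool" where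
  "less_eq_gpuiseux f g \<longleftrightarrow> f = g \<or> f < g"

definition abs_gpuiseux :: "gpuiseux \<Rightarrow> gpuiseux" where
  "abs_gpuiseux f = (if f < 0 then - f else f)"

definition sgn_gpuiseux :: "gpuiseux \<Rightarrow> gpuiseux" where
  "sgn_gpuiseux f = (if f = 0 then 0 else if 0 < f then 1 else - 1)"

instance
proof
  fix a b c :: gpuiseux
  have asym: "\<not> (a < b \<and> b < a)" for a b :: gpuiseux
    using gpos_add[of "b - a" "a - b"] gpos_not_zero by (auto simp: less_gpuiseux_def)
  have trans: "a < c" if "a < b" "b < c" for a b c :: gpuiseux
    using gpos_add[of "c - b" "b - a"] that by (auto simp: less_gpuiseux_def)
  show "(a < b) = (a \<le> b \<and> \<not> b \<le> a)"
    using asym[of a b] asym[of a a] by (auto simp: less_eq_gpuiseux_def)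
  show "a \<le> a" by (simp add: less_eq_gpuiseux_def)
  show "a \<le> c" if "a \<le> b" "b \<le> c"
    using that trans by (auto simp: less_eq_gpuiseux_def)
  show "a = b" if "a \<le> b" "b \<le> a"
    using that asym by (auto simp: less_eq_gpuiseux_def)
  show "a \<le> b \<or> b \<le> a"
    using gpos_total[of "b - a"] by (auto simp: less_eq_gpuiseux_def less_gpuiseux_def)
  show "c + a \<le> c + b" if "a \<le> b"
    using that by (auto simp: less_eq_gpuiseux_def less_gpuiseux_def)
  show "c * a < c * b" if "a < b" "0 < c"
    using that gpos_mult[of c "b - a"] by (simp add: less_gpuiseux_def right_diff_distrib)
qed (simp_all add: abs_gpuiseux_def sgn_gpuiseux_def)

end

lemma gpuiseux_pos_iff: "0 < f \<longleftrightarrow> (\<exists>b. gcoeff f b > 0 \<and> (\<forall>c>b. gcoeff f c = 0))"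
  by (simp add: less_gpuiseux_def gpos_def)

text \<open>The constant series are the image of \<open>of_real\<close>.\<close>

instantiation gpuiseux :: real_field
begin

lift_definition scaleR_gpuiseux :: "real \<Rightarrow> gpuiseux \<Rightarrow> gpuiseux" is "\<lambda>r f b. r * f b"
  unfolding psupp by (rule locfin_supp_scale)

lemma scaleR_gpuiseux_conv_mult: "r *\<^sub>R f = gmonom r 0 * f"
  by (rule gpuiseux_eqI) (simp add: gmonom_mult scaleR_gpuiseux.rep_eq)

instance
proof
  fix r :: real and a b :: gpuiseux
  show "r *\<^sub>R a * b = r *\<^sub>R (a * b)" "a * r *\<^sub>R b = r *\<^sub>R (a * b)"
    by (simp_all add: scaleR_gpuiseux_conv_mult ac_simps)
qed (transfer; simp add: fun_eq_iff algebra_simps)+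

end

lemma gcoeff_of_real: "gcoeff (of_real r) b = (if b = 0 then r else 0)"
  by (simp add: of_real_def scaleR_gpuiseux.rep_eq one_gpuiseux.rep_eq)

lemma of_real_less_gpuiseux_iff: "(of_real r :: gpuiseux) < of_real s \<longleftrightarrow> r < s"
proof -
  have "(of_real r :: gpuiseux) < of_real s \<longleftrightarrow> 0 < (of_real (s - r) :: gpuiseux)"
    by simp
  also have "\<dots> \<longleftrightarrow> r < s"
    unfolding gpuiseux_pos_iff gcoeff_of_real by (auto split: if_splits)
  finally show ?thesis .
qed

section \<open>Total positivity\<close>

text \<open>
  Row and column indices start at \<open>0\<close>.  The matrix \<open>submatrix A I J\<close> keeps the rows in \<open>I\<close> and the
  columns in \<open>J\<close> in increasing order.  The minors of \<open>A\<close> are the determinants of its non-empty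
  square submatrices.
\<close>

definition minors :: "'a :: comm_ring_1 mat \<Rightarrow> 'a set" where
  "minors A = {det (submatrix A I J) | I J.
     I \<subseteq> {..<dim_row A} \<and> J \<subseteq> {..<dim_col A} \<and> card I = card J \<and> I \<noteq> {}}"

definition TP :: "gpuiseux mat set" where
  "TP = {A. \<forall>x\<in>minors A. 0 < x}"

definition TN :: "gpuiseux mat set" where
  "TN = {A. \<forall>x\<in>minors A. 0 \<le> x}"

definition TP2 :: "gpuiseux \<Rightarrow> gpuiseux mat set" where
  "TP2 C = {A.
     (\<forall>i<dim_row A. \<forall>j<dim_col A. 0 < A $$ (i, j)) \<and>
     (\<forall>i i' j j'. i < i' \<and> i' < dim_row A \<and> j < j' \<and> j' < dim_col A \<longrightarrow>
        A $$ (i, j) * A $$ (i', j') > C * A $$ (i, j') * A $$ (i', j))}"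

definition TN2 :: "gpuiseux \<Rightarrow> gpuiseux mat set" where
  "TN2 C = {A.
     (\<forall>i<dim_row A. \<forall>j<dim_col A. 0 \<le> A $$ (i, j)) \<and>
     (\<forall>i i' j j'. i < i' \<and> i' < dim_row A \<and> j < j' \<and> j' < dim_col A \<longrightarrow>
        A $$ (i, j) * A $$ (i', j') \<ge> C * A $$ (i, j') * A $$ (i', j))}"

end

theory Submission
  imports Defs
begin

text \<open>
  A submatrix inherits the inequalities between \<open>2 \<times> 2\<close> products, and a \<open>k \<times> k\<close> submatrix has
  \<open>k \<le> min n m\<close>.  So it is enough to find the sign of \<open>det A\<close> when \<open>A\<close> is \<open>n \<times> n\<close> and
  \<open>C \<ge> max 1 ((n - 1)\<^sup>2)\<close>.  This works over every linearly ordered field.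

  Suppose first that the diagonal of \<open>A\<close> is positive, and let \<open>s = max 1 (n - 1)\<close>.  It is enough
  to find positive column weights \<open>d\<close> with \<open>s a\<^sub>i\<^sub>j d\<^sub>j \<le> a\<^sub>i\<^sub>i d\<^sub>i\<close> for \<open>i \<noteq> j\<close>: then each of the \<open>n - 1\<close>
  off-diagonal entries in row \<open>i\<close> of the scaled matrix is at most \<open>1 / (n - 1)\<close> of the diagonal
  one, so the scaled matrix is diagonally dominant.  For \<open>j = i + 1\<close> and \<open>i = j + 1\<close>
  these are an upper and a lower bound on the ratio \<open>d\<^sub>i\<^sub>+\<^sub>1 / d\<^sub>i\<close>, and they are compatible
  (\<open>ratio_between\<close>) because
  \<open>s\<^sup>2 a\<^sub>i\<^sub>,\<^sub>i\<^sub>+\<^sub>1 a\<^sub>i\<^sub>+\<^sub>1\<^sub>,\<^sub>i \<le> a\<^sub>i\<^sub>i a\<^sub>i\<^sub>+\<^sub>1\<^sub>,\<^sub>i\<^sub>+\<^sub>1\<close>; this is where the constant \<open>(n - 1)\<^sup>2\<close> comes from.  For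
  entries further from the diagonal nothing remains to be chosen: the inequality for the rows \<open>i, j\<close>
  and the columns \<open>j, j + 1\<close> shows that \<open>a\<^sub>i\<^sub>j d\<^sub>j\<close> decreases away from the diagonal
  (\<open>scaled_row_decreases\<close>).

  A diagonally dominant matrix with nonnegative diagonal has a nonnegative determinant, and a
  positive one if the dominance is strict.  Over the reals one deforms the matrix to its diagonal
  and uses continuity.  Over a general ordered field, \<open>det_diagonally_dominant\<close> is an induction
  on the size, since dominance passes to the Schur complement of a diagonal entry.

  If some diagonal entry of \<open>A\<close> vanishes, then the inequalities with \<open>C = 1\<close> already make every
  product in the Leibniz expansion vanish, and \<open>det A = 0\<close> (\<open>det_zero_diagonal\<close>).
\<close>

section \<open>Diagonally dominant determinants over an ordered field\<close>

lemma det_eq_0_if_transversals_vanish: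
  fixes A :: "'a::comm_ring_1 mat"
  assumes A: "A \<in> carrier_mat n n"
    and zero: "\<And>p. p permutes {..<n} \<Longrightarrow> \<exists>k<n. A $$ (k, p k) = 0"
  shows "det A = 0"
proof -
  have "(\<Prod>i=0..<n. A $$ (i, p i)) = 0" if p: "p permutes {0..<n}" for p
  proof -
    obtain k where "k < n" "A $$ (k, p k) = 0"
      using zero[of p] p by (auto simp: atLeast0LessThan)
    then show ?thesis by (intro prod_zero) auto
  qed
  then show ?thesis by (simp add: det_def'[OF A])
qed

text \<open>
  The factorization behind this is
  \<open>A = [S, b; 0, p] [1, 0; r / p, 1]\<close>, where \<open>p\<close> is the last diagonal entry, \<open>b\<close> the rest of its
  column, \<open>r\<close> the rest of its row and \<open>S\<close> the Schur complement.
\<close>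

lemma det_schur_complement:
  fixes A :: "'a::field mat"
  assumes A: "A \<in> carrier_mat (Suc n) (Suc n)" and p: "A $$ (n,n) \<noteq> 0"
  shows "det A = A $$ (n,n) *
    det (mat n n (\<lambda>(i,j). A $$ (i,j) - A $$ (i,n) * A $$ (n,j) / A $$ (n,n)))"
proof -
  let ?p = "A $$ (n,n)"
  let ?S = "mat n n (\<lambda>(i,j). A $$ (i,j) - A $$ (i,n) * A $$ (n,j) / ?p)"
  let ?B = "mat n 1 (\<lambda>(i,j). A $$ (i,n))"
  let ?P = "mat 1 1 (\<lambda>(i,j). ?p)"
  let ?R = "mat 1 n (\<lambda>(i,j). A $$ (n,j) / ?p)"
  let ?U = "four_block_mat ?S ?B (0\<^sub>m 1 n) ?P"
  let ?L = "four_block_mat (1\<^sub>m n) (0\<^sub>m n 1) ?R (1\<^sub>m 1)"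
  have "?U * ?L = four_block_mat (?S * 1\<^sub>m n + ?B * ?R) (?S * 0\<^sub>m n 1 + ?B * 1\<^sub>m 1)
      (0\<^sub>m 1 n * 1\<^sub>m n + ?P * ?R) (0\<^sub>m 1 n * 0\<^sub>m n 1 + ?P * 1\<^sub>m 1)"
    by (rule mult_four_block_mat) auto
  also have "\<dots> = A"
    using A p by (intro eq_matI) (auto simp: scalar_prod_def less_Suc_eq)
  finally have UL: "A = ?U * ?L" by simp
  have "det A = det ?U * det ?L"
    by (subst UL, rule det_mult[of _ "n + 1"]) auto
  also have "det ?U = det ?S * det ?P"
    by (rule det_four_block_mat_lower_left_zero) auto
  also have "det ?L = det (1\<^sub>m n :: 'a mat) * det (1\<^sub>m 1 :: 'a mat)"
    by (rule det_four_block_mat_upper_right_zero) auto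
  also have "det ?P = ?p"
    by (subst det_single) auto
  finally show ?thesis by (simp add: mult.commute)
qed

text \<open>
  Write \<open>p\<close> for the last diagonal entry.  Passing to the Schur complement adds to row \<open>i\<close> the
  multiple \<open>- a\<^sub>i\<^sub>n / p\<close> of row \<open>n\<close>.  This costs row \<open>i\<close> at most
  \<open>\<bar>a\<^sub>i\<^sub>n\<bar> / p\<close> times the absolute row sum of row \<open>n\<close> off the pivot, so at most \<open>\<bar>a\<^sub>i\<^sub>n\<bar>\<close>;
  that much is gained as the entry \<open>a\<^sub>i\<^sub>n\<close> disappears.  Thus the surplus of the diagonal entry over
  the rest of its row does not shrink (the fact \<open>slack\<close>), and the weak and the strict claim go
  through the same induction.
\<close>

lemma det_diagonally_dominant:
  fixes A :: "'a::linordered_field mat"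
  assumes "A \<in> carrier_mat n n"
    and "\<And>i. i < n \<Longrightarrow> (\<Sum>j\<in>{..<n} - {i}. \<bar>A $$ (i,j)\<bar>) \<le> A $$ (i,i)"
  shows "0 \<le> det A \<and> ((\<forall>i<n. (\<Sum>j\<in>{..<n} - {i}. \<bar>A $$ (i,j)\<bar>) < A $$ (i,i)) \<longrightarrow> 0 < det A)"
  using assms
proof (induction n arbitrary: A)
  case 0
  then show ?case by simp
next
  case (Suc n)
  note A = Suc.prems(1) and dom = Suc.prems(2)
  let ?p = "A $$ (n,n)"
  have last: "{..<Suc n} - {n} = {..<n}" by auto
  have rown_ge: "0 \<le> (\<Sum>j<n. \<bar>A $$ (n,j)\<bar>)" by (rule sum_nonneg) simp
  also have rown_le: "\<dots> \<le> ?p" using dom[of n] unfolding last by simp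
  finally have p_ge: "0 \<le> ?p" .
  show ?case
  proof (cases "?p = 0")
    case True
    \<comment> \<open>Dominance forces the whole last row to vanish.\<close>
    have "(\<Sum>j<n. \<bar>A $$ (n,j)\<bar>) = 0"
      using rown_ge rown_le True by linarith
    then have "A $$ (n,j) = 0" if "j < Suc n" for j
      using that True by (subst (asm) sum_nonneg_eq_0_iff) (auto simp: less_Suc_eq)
    then have "\<exists>k<Suc n. A $$ (k, p k) = 0" if "p permutes {..<Suc n}" for p
      using permutes_in_image[OF that, of n] by (intro exI[of _ n]) simp
    then have "det A = 0" by (rule det_eq_0_if_transversals_vanish[OF A])
    moreover have "\<not> (\<Sum>j\<in>{..<Suc n} - {n}. \<bar>A $$ (n,j)\<bar>) < ?p"
      using True by (simp add: not_less sum_nonneg)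
    ultimately show ?thesis by auto
  next
    case False
    then have p: "0 < ?p" using p_ge by simp
    define s where "s i j = A $$ (i,j) - A $$ (i,n) * A $$ (n,j) / ?p" for i j
    let ?S = "mat n n (\<lambda>(i,j). s i j)"
    have slack: "(\<Sum>j\<in>{..<n} - {i}. \<bar>s i j\<bar>) + (A $$ (i,i) - (\<Sum>j\<in>{..<Suc n} - {i}. \<bar>A $$ (i,j)\<bar>))
        \<le> s i i" if i: "i < n" for i
    proof -
      let ?q = "\<bar>A $$ (i,n)\<bar> / ?p"
      have split: "(\<Sum>j\<in>{..<Suc n} - {i}. \<bar>A $$ (i,j)\<bar>)
          = (\<Sum>j\<in>{..<n} - {i}. \<bar>A $$ (i,j)\<bar>) + \<bar>A $$ (i,n)\<bar>"
      proof -
        have "{..<Suc n} - {i} = insert n ({..<n} - {i})" using i by auto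
        then show ?thesis by (simp add: add.commute)
      qed
      have rown: "(\<Sum>j\<in>{..<n} - {i}. \<bar>A $$ (n,j)\<bar>) + \<bar>A $$ (n,i)\<bar> \<le> ?p"
        using dom[of n] i unfolding last by (simp add: sum.remove[of "{..<n}" i] add.commute)
      have "(\<Sum>j\<in>{..<n} - {i}. \<bar>s i j\<bar>)
          \<le> (\<Sum>j\<in>{..<n} - {i}. \<bar>A $$ (i,j)\<bar> + ?q * \<bar>A $$ (n,j)\<bar>)"
      proof (rule sum_mono)
        fix j
        have "\<bar>s i j\<bar> \<le> \<bar>A $$ (i,j)\<bar> + \<bar>A $$ (i,n) * A $$ (n,j) / ?p\<bar>"
          unfolding s_def by (rule abs_triangle_ineq4)
        then show "\<bar>s i j\<bar> \<le> \<bar>A $$ (i,j)\<bar> + ?q * \<bar>A $$ (n,j)\<bar>"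
          using p by (simp add: abs_mult)
      qed
      also have "\<dots> = (\<Sum>j\<in>{..<n} - {i}. \<bar>A $$ (i,j)\<bar>) + ?q * (\<Sum>j\<in>{..<n} - {i}. \<bar>A $$ (n,j)\<bar>)"
        by (simp add: sum.distrib sum_distrib_left)
      also have "?q * (\<Sum>j\<in>{..<n} - {i}. \<bar>A $$ (n,j)\<bar>) \<le> ?q * (?p - \<bar>A $$ (n,i)\<bar>)"
        using rown p by (intro mult_left_mono) auto
      also have "\<dots> = \<bar>A $$ (i,n)\<bar> - \<bar>A $$ (i,n) * A $$ (n,i) / ?p\<bar>"
        using p by (simp add: field_simps abs_mult)
      finally show ?thesis
        unfolding split s_def using abs_ge_self[of "A $$ (i,n) * A $$ (n,i) / ?p"] by linarith
    qed
    have "0 \<le> det ?S \<and> ((\<forall>i<n. (\<Sum>j\<in>{..<n} - {i}. \<bar>?S $$ (i,j)\<bar>) < ?S $$ (i,i)) \<longrightarrow> 0 < det ?S)"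
    proof (rule Suc.IH)
      show "(\<Sum>j\<in>{..<n} - {i}. \<bar>?S $$ (i,j)\<bar>) \<le> ?S $$ (i,i)" if "i < n" for i
        using slack[OF that] dom[of i] that by simp
    qed simp
    moreover have "(\<Sum>j\<in>{..<n} - {i}. \<bar>?S $$ (i,j)\<bar>) < ?S $$ (i,i)"
      if "\<forall>i<Suc n. (\<Sum>j\<in>{..<Suc n} - {i}. \<bar>A $$ (i,j)\<bar>) < A $$ (i,i)" "i < n" for i
    proof -
      have "(\<Sum>j\<in>{..<Suc n} - {i}. \<bar>A $$ (i,j)\<bar>) < A $$ (i,i)" using that by simp
      then show ?thesis using slack[OF that(2)] that(2) by simp
    qed
    moreover have "det A = ?p * det ?S"
      unfolding s_def by (rule det_schur_complement[OF A False])
    ultimately show ?thesis using p by (simp add: zero_less_mult_iff)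
  qed
qed

lemma det_scale_columns:
  fixes A :: "'a::comm_ring_1 mat"
  assumes A: "A \<in> carrier_mat n n"
  shows "det (mat n n (\<lambda>(i,j). A $$ (i,j) * d j)) = det A * (\<Prod>j<n. d j)"
proof -
  have "(\<Prod>i=0..<n. mat n n (\<lambda>(i,j). A $$ (i,j) * d j) $$ (i, p i))
      = (\<Prod>i=0..<n. A $$ (i, p i)) * (\<Prod>j<n. d j)" if p: "p permutes {0..<n}" for p
  proof -
    have "(\<Prod>i=0..<n. mat n n (\<lambda>(i,j). A $$ (i,j) * d j) $$ (i, p i))
        = (\<Prod>i=0..<n. A $$ (i, p i) * d (p i))"
      using permutes_in_image[OF p] by (intro prod.cong) auto
    also have "\<dots> = (\<Prod>i=0..<n. A $$ (i, p i)) * (\<Prod>i=0..<n. d i)"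
      using prod.permute[OF p, of d] by (simp add: prod.distrib comp_def)
    finally show ?thesis by (simp add: atLeast0LessThan)
  qed
  then show ?thesis
    by (simp add: det_def'[OF A] det_def'[of _ n] sum_distrib_right mult.assoc)
qed

section \<open>A zero on the diagonal\<close>

text \<open>
  Suppose that no entry \<open>a\<^sub>k\<^sub>,\<^sub>p\<^sub>k\<close> vanishes.  Since \<open>a\<^sub>i\<^sub>i = 0\<close>, the inequality forbids positive
  entries both to the right of and below position \<open>(i, i)\<close>, and also both to the left of and
  above it.  As \<open>a\<^sub>i\<^sub>,\<^sub>p\<^sub>i\<close> is on the right, the entry that \<open>p\<close> selects in column \<open>i\<close> must lie above.  By
  counting, \<open>p\<close> also selects an entry strictly below and to the left of \<open>(i, i)\<close>.  Together with
  \<open>a\<^sub>i\<^sub>,\<^sub>p\<^sub>i\<close>, that entry forces a positive entry in row \<open>i\<close> on the left, which is forbidden.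
\<close>

lemma permutation_meets_zero_above:
  fixes a :: "nat \<Rightarrow> nat \<Rightarrow> 'a::linordered_field"
  assumes nonneg: "\<And>i j. i < n \<Longrightarrow> j < n \<Longrightarrow> 0 \<le> a i j"
    and two: "\<And>i i' j j'. i < i' \<Longrightarrow> i' < n \<Longrightarrow> j < j' \<Longrightarrow> j' < n \<Longrightarrow>
      a i j' * a i' j \<le> a i j * a i' j'"
    and p: "p permutes {..<n}" and i: "i < n" and zero: "a i i = 0" and up: "i < p i"
  shows "\<exists>k<n. a k (p k) = 0"
proof (rule ccontr)
  assume "\<not> (\<exists>k<n. a k (p k) = 0)"
  moreover have pn: "p k < n" if "k < n" for k using permutes_in_image[OF p, of k] that by simp
  ultimately have pos: "0 < a k (p k)" if "k < n" for k
    using nonneg[of k "p k"] that by (metis order.not_eq_order_implies_strict)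
  have inj: "inj p" using p by (rule permutes_inj)
  obtain q where q: "q < n" "p q = i"
    using permutes_image[OF p] i by (metis imageE lessThan_iff)
  have "q \<noteq> i" using q up by auto
  have "\<not> i < q"
  proof
    assume "i < q"
    then have "a i (p i) * a q i \<le> a i i * a q (p i)" using q up pn[OF i] by (intro two) auto
    moreover have "0 < a i (p i) * a q i" using pos[OF i] pos[OF q(1)] q by simp
    ultimately show False using zero by simp
  qed
  then have qi: "q < i" using \<open>q \<noteq> i\<close> by simp
  \<comment> \<open>Otherwise \<open>p\<close> would embed \<open>{i..<n}\<close> into \<open>{i + 1..<n}\<close>, as column \<open>i\<close> is taken by row \<open>q < i\<close>.\<close>
  obtain k where k: "i < k" "k < n" "p k < i"
  proof -
    have "\<not> p ` {i..<n} \<subseteq> {Suc i..<n}"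
    proof
      assume "p ` {i..<n} \<subseteq> {Suc i..<n}"
      then have "card (p ` {i..<n}) \<le> card {Suc i..<n}" by (intro card_mono) auto
      then show False using i by (simp add: card_image inj_on_subset[OF inj])
    qed
    then obtain k where "i \<le> k" "k < n" "\<not> Suc i \<le> p k"
      using pn by (meson atLeastLessThan_iff image_subsetI)
    moreover have "p k \<noteq> i" using q qi \<open>i \<le> k\<close> inj by (metis injD leD)
    moreover have "k \<noteq> i" using up \<open>\<not> Suc i \<le> p k\<close> by auto
    ultimately show thesis using that[of k] by linarith
  qed
  have "a i (p i) * a k (p k) \<le> a i (p k) * a k (p i)"
    using k up pn[OF i] by (intro two) auto
  then have "a i (p k) \<noteq> 0"
    using mult_pos_pos[OF pos[OF i] pos[OF k(2)]] by auto
  then have "0 < a i (p k)" using nonneg[OF i pn[OF k(2)]] by simp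
  moreover have "a q i * a i (p k) \<le> a q (p k) * a i i"
    using k qi i by (intro two) auto
  moreover have "0 < a q i" using pos[OF q(1)] q by simp
  ultimately show False using zero by (simp add: mult_le_0_iff)
qed

lemma det_zero_diagonal:
  fixes A :: "'a::linordered_field mat"
  assumes A: "A \<in> carrier_mat n n"
    and nonneg: "\<And>i j. i < n \<Longrightarrow> j < n \<Longrightarrow> 0 \<le> A $$ (i,j)"
    and two: "\<And>i i' j j'. i < i' \<Longrightarrow> i' < n \<Longrightarrow> j < j' \<Longrightarrow> j' < n \<Longrightarrow>
      A $$ (i,j') * A $$ (i',j) \<le> A $$ (i,j) * A $$ (i',j')"
    and i: "i < n" and zero: "A $$ (i,i) = 0"
  shows "det A = 0"
proof -
  have "\<exists>k<n. A $$ (k, p k) = 0" if p: "p permutes {..<n}" for p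
  proof (cases "p i" i rule: linorder_cases)
    case equal
    then show ?thesis using i zero by metis
  next
    case greater
    show ?thesis
      by (rule permutation_meets_zero_above[where i = i and a = "\<lambda>i j. A $$ (i,j)"])
        (use p i zero greater nonneg two in auto)
  next
    case less
    \<comment> \<open>Either \<open>(q, i)\<close> above and \<open>(i, p i)\<close> on the left clash at once, or \<open>i < q\<close> and the
      previous lemma applies to the transpose and the inverse permutation.\<close>
    obtain q where q: "q < n" "p q = i"
      using permutes_image[OF p] i by (metis imageE lessThan_iff)
    let ?p' = "inv_into UNIV p"
    have inv: "?p' i = q" using q permutes_inj[OF p] by auto
    have "q \<noteq> i" using q less by auto
    then consider "q < i" | "i < q" by linarith
    then show ?thesis
    proof cases
      case 1
      then have "A $$ (q,i) * A $$ (i, p i) \<le> A $$ (q, p i) * A $$ (i,i)"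
        using less i by (intro two) auto
      then have "A $$ (q,i) = 0 \<or> A $$ (i,p i) = 0"
        using nonneg[OF q(1) i] nonneg[of i "p i"] less i zero
        by (auto simp: mult_le_0_iff)
      then show ?thesis using q i by metis
    next
      case 2
      have "\<exists>k<n. A $$ (?p' k, k) = 0"
        by (rule permutation_meets_zero_above[where i = i and a = "\<lambda>i j. A $$ (j,i)"])
          (use permutes_inv[OF p] i zero 2 nonneg two inv in \<open>auto simp: mult.commute\<close>)
      then obtain k where "k < n" "A $$ (?p' k, k) = 0" by blast
      then show ?thesis
        using permutes_in_image[OF permutes_inv[OF p], of k] permutes_inverses(1)[OF p, of k]
        by (intro exI[of _ "?p' k"]) auto
    qed
  qed
  then show ?thesis by (rule det_eq_0_if_transversals_vanish[OF A])
qed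

section \<open>Column scaling\<close>

text \<open>
  The admissible ratios fill the interval from \<open>s y / q\<close> to \<open>p / (s x)\<close>, unbounded above
  if \<open>x = 0\<close>.  Choosing the ratio inside
  it avoids the square root that a symmetric scaling would need.  The strict bounds
  are part of the conclusion so that a single choice serves \<open>TN\<close> and \<open>TP\<close>.
\<close>

lemma ratio_between:
  fixes x y p q s :: "'a::linordered_field"
  assumes "0 \<le> x" "0 \<le> y" "0 < p" "0 < q" "0 < s" and le: "s^2 * (x * y) \<le> p * q"
  shows "\<exists>r>0. s * x * r \<le> p \<and> s * y \<le> q * r \<and>
    (s^2 * (x * y) < p * q \<longrightarrow> s * x * r < p \<and> s * y < q * r)"
proof (cases "x = 0")
  case True
  have "0 \<le> s * y" using assms by simp
  then have "0 < s * y / q + 1" using assms by (simp add: add_nonneg_pos)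
  moreover have "q * (s * y / q + 1) = s * y + q" using assms by (simp add: field_simps)
  ultimately show ?thesis
    using True assms by (intro exI[of _ "s * y / q + 1"]) auto
next
  case False
  then have x: "0 < s * x" using assms by simp
  show ?thesis
  proof (cases "s^2 * (x * y) < p * q")
    case True
    then have "s * y / q < p / (s * x)"
      using x assms by (simp add: field_simps power2_eq_square)
    then obtain r where r: "s * y / q < r" "r < p / (s * x)" using dense by blast
    have "0 < r" using r(1) assms by (meson divide_nonneg_pos le_less_trans less_imp_le mult_nonneg_nonneg)
    moreover have "s * x * r < p" using r(2) x by (simp add: less_divide_eq mult.commute)
    moreover have "s * y < q * r" using r(1) assms by (simp add: divide_less_eq mult.commute)
    ultimately show ?thesis by (intro exI[of _ r]) auto
  next
    case False
    with x assms show ?thesis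
      by (intro exI[of _ "p / (s * x)"]) (auto simp: field_simps power2_eq_square)
  qed
qed

text \<open>
  To the right of the diagonal, the inequality for the rows \<open>i < j\<close> and the columns \<open>j < j + 1\<close>
  gives \<open>a\<^sub>i\<^sub>,\<^sub>j\<^sub>+\<^sub>1 / a\<^sub>i\<^sub>j \<le> a\<^sub>j\<^sub>,\<^sub>j\<^sub>+\<^sub>1 / a\<^sub>j\<^sub>j\<close>, and the right-hand side is at most \<open>d\<^sub>j / d\<^sub>j\<^sub>+\<^sub>1\<close>: the ratio in
  the row whose diagonal lies in column \<open>j\<close> bounds the ratio in every row above.  The left side is
  symmetric.
\<close>

lemma scaled_row_decreases:
  fixes a :: "nat \<Rightarrow> nat \<Rightarrow> 'a::linordered_field"
  assumes nonneg: "\<And>i j. i < n \<Longrightarrow> j < n \<Longrightarrow> 0 \<le> a i j"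
    and diag: "\<And>i. i < n \<Longrightarrow> 0 < a i i"
    and two: "\<And>i i' j j'. i < i' \<Longrightarrow> i' < n \<Longrightarrow> j < j' \<Longrightarrow> j' < n \<Longrightarrow>
      a i j' * a i' j \<le> a i j * a i' j'"
    and d: "\<And>i. 0 < d i"
    and upper: "\<And>i. Suc i < n \<Longrightarrow> a i (Suc i) * d (Suc i) \<le> a i i * d i"
    and lower: "\<And>i. Suc i < n \<Longrightarrow> a (Suc i) i * d i \<le> a (Suc i) (Suc i) * d (Suc i)"
  shows "i < j \<Longrightarrow> j < n \<Longrightarrow> a i j * d j \<le> a i (Suc i) * d (Suc i)"
    and "j \<le> i \<Longrightarrow> Suc i < n \<Longrightarrow> a (Suc i) j * d j \<le> a (Suc i) i * d i"
proof -
  show "a i j * d j \<le> a i (Suc i) * d (Suc i)" if "i < j" "j < n"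
  proof -
    from \<open>i < j\<close> have "Suc i \<le> j" by simp
    from this \<open>j < n\<close> show ?thesis
    proof (induction j rule: dec_induct)
      case (step j)
      have "a i (Suc j) * d (Suc j) * a j j = a i (Suc j) * a j j * d (Suc j)" by simp
      also have "\<dots> \<le> a i j * a j (Suc j) * d (Suc j)"
        using step d[of "Suc j"] by (intro mult_right_mono two) auto
      also have "\<dots> \<le> a i j * (a j j * d j)"
        using upper[of j] nonneg[of i j] step by (simp add: mult_left_mono mult.assoc)
      finally have "a i (Suc j) * d (Suc j) * a j j \<le> (a i j * d j) * a j j" by (simp add: ac_simps)
      then have "a i (Suc j) * d (Suc j) \<le> a i j * d j"
        by (rule mult_right_le_imp_le) (use diag step in simp)
      then show ?case using step by simp
    qed simp
  qed
  show "a (Suc i) j * d j \<le> a (Suc i) i * d i" if "j \<le> i" "Suc i < n"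
    using that
  proof (induction j rule: inc_induct)
    case (step j)
    have "a (Suc i) j * d j * a (Suc j) (Suc j) = a (Suc j) (Suc j) * a (Suc i) j * d j" by simp
    also have "\<dots> \<le> a (Suc j) j * a (Suc i) (Suc j) * d j"
      using step d[of j] by (intro mult_right_mono two) auto
    also have "\<dots> \<le> a (Suc i) (Suc j) * (a (Suc j) (Suc j) * d (Suc j))"
      using lower[of j] nonneg[of "Suc i" "Suc j"] step
      by (simp add: mult_left_mono mult.assoc mult.left_commute[of "a (Suc j) j"])
    finally have "a (Suc i) j * d j * a (Suc j) (Suc j)
        \<le> (a (Suc i) (Suc j) * d (Suc j)) * a (Suc j) (Suc j)" by (simp add: ac_simps)
    then have "a (Suc i) j * d j \<le> a (Suc i) (Suc j) * d (Suc j)"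
        by (rule mult_right_le_imp_le) (use diag step in simp)
    then show ?case using step by simp
  qed simp
qed

section \<open>Minors\<close>

text \<open>
  For strictness it is enough that the diagonal is positive and that the inequalities for adjacent
  rows and columns on the diagonal are strict, because only those enter the choice of the weights.
\<close>

lemma det_of_two_minors:
  fixes A :: "'a::linordered_field mat"
  assumes A: "A \<in> carrier_mat n n"
    and nonneg: "\<And>i j. i < n \<Longrightarrow> j < n \<Longrightarrow> 0 \<le> A $$ (i,j)"
    and two: "\<And>i i' j j'. i < i' \<Longrightarrow> i' < n \<Longrightarrow> j < j' \<Longrightarrow> j' < n \<Longrightarrow>
      C * A $$ (i,j') * A $$ (i',j) \<le> A $$ (i,j) * A $$ (i',j')"
    and C: "1 \<le> C" "(of_nat n - 1)^2 \<le> C"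
  shows "0 \<le> det A"
    and "(\<And>i. i < n \<Longrightarrow> 0 < A $$ (i,i)) \<Longrightarrow>
      (\<And>i. Suc i < n \<Longrightarrow> C * A $$ (i,Suc i) * A $$ (Suc i,i) < A $$ (i,i) * A $$ (Suc i,Suc i)) \<Longrightarrow>
      0 < det A"
proof -
  have two': "A $$ (i,j') * A $$ (i',j) \<le> A $$ (i,j) * A $$ (i',j')"
    if "i < i'" "i' < n" "j < j'" "j' < n" for i i' j j'
  proof -
    have "1 * (A $$ (i,j') * A $$ (i',j)) \<le> C * (A $$ (i,j') * A $$ (i',j))"
      using nonneg that C by (intro mult_right_mono) auto
    then show ?thesis using two[OF that] by (simp add: mult.assoc)
  qed
  have main: "0 \<le> det A \<and>
      ((\<forall>i. Suc i < n \<longrightarrow> C * A $$ (i,Suc i) * A $$ (Suc i,i) < A $$ (i,i) * A $$ (Suc i,Suc i)) \<longrightarrow>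
      0 < det A)" (is "_ \<and> (?strict \<longrightarrow> _)")
    if diag: "\<And>i. i < n \<Longrightarrow> 0 < A $$ (i,i)"
  proof -
    \<comment> \<open>The maximum keeps \<open>s\<close> positive when \<open>n = 1\<close>.\<close>
    define s :: 'a where "s = max 1 (of_nat n - 1)"
    have s: "1 \<le> s" "of_nat n - 1 \<le> s" "s^2 \<le> C" using C by (auto simp: s_def max_def)
    have sC: "s^2 * (A $$ (i,Suc i) * A $$ (Suc i,i)) \<le> C * A $$ (i,Suc i) * A $$ (Suc i,i)"
      if "Suc i < n" for i
      using s(3) nonneg that by (simp add: mult_right_mono mult.assoc)
    have "\<exists>r>0. Suc i < n \<longrightarrow> s * A $$ (i,Suc i) * r \<le> A $$ (i,i) \<and>
        s * A $$ (Suc i,i) \<le> A $$ (Suc i,Suc i) * r \<and>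
        (?strict \<longrightarrow> s * A $$ (i,Suc i) * r < A $$ (i,i) \<and>
          s * A $$ (Suc i,i) < A $$ (Suc i,Suc i) * r)" for i
    proof (cases "Suc i < n")
      case True
      have le: "s^2 * (A $$ (i,Suc i) * A $$ (Suc i,i)) \<le> A $$ (i,i) * A $$ (Suc i,Suc i)"
        using sC[OF True] two[of i "Suc i" i "Suc i"] True by simp
      have "s^2 * (A $$ (i,Suc i) * A $$ (Suc i,i)) < A $$ (i,i) * A $$ (Suc i,Suc i)" if ?strict
        using sC[OF True] that True by (meson le_less_trans)
      then show ?thesis
        using ratio_between[OF _ _ _ _ _ le] nonneg diag s(1) True by (auto simp: Suc_lessD)
    qed (auto intro: exI[of _ 1])
    then obtain r where r0: "\<And>i. 0 < r i"
      and r: "\<And>i. Suc i < n \<Longrightarrow> s * A $$ (i,Suc i) * r i \<le> A $$ (i,i) \<and>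
          s * A $$ (Suc i,i) \<le> A $$ (Suc i,Suc i) * r i"
      and r': "\<And>i. Suc i < n \<Longrightarrow> ?strict \<Longrightarrow> s * A $$ (i,Suc i) * r i < A $$ (i,i) \<and>
          s * A $$ (Suc i,i) < A $$ (Suc i,Suc i) * r i"
      by metis
    define d where "d j = (\<Prod>i<j. r i)" for j
    have d: "0 < d j" for j unfolding d_def using r0 by (intro prod_pos) auto
    have d_Suc: "d (Suc j) = d j * r j" for j by (simp add: d_def)
    have upper: "s * (A $$ (i,Suc i) * d (Suc i)) \<le> A $$ (i,i) * d i" if "Suc i < n" for i
      using mult_right_mono[OF conjunct1[OF r[OF that]], of "d i"] d[of i]
      by (simp add: d_Suc ac_simps)
    have lower: "s * (A $$ (Suc i,i) * d i) \<le> A $$ (Suc i,Suc i) * d (Suc i)" if "Suc i < n" for i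
      using mult_right_mono[OF conjunct2[OF r[OF that]], of "d i"] d[of i]
      by (simp add: d_Suc ac_simps)
    have upper': "s * (A $$ (i,Suc i) * d (Suc i)) < A $$ (i,i) * d i" if "Suc i < n" ?strict for i
      using mult_strict_right_mono[OF conjunct1[OF r'[OF that]], of "d i"] d[of i]
      by (simp add: d_Suc ac_simps)
    have lower': "s * (A $$ (Suc i,i) * d i) < A $$ (Suc i,Suc i) * d (Suc i)"
      if "Suc i < n" ?strict for i
      using mult_strict_right_mono[OF conjunct2[OF r'[OF that]], of "d i"] d[of i]
      by (simp add: d_Suc ac_simps)
    \<comment> \<open>As \<open>s \<ge> 1\<close>, the bounds with the factor \<open>s\<close> imply those that \<open>scaled_row_decreases\<close> needs.\<close>
    have drop: "x \<le> y" if "s * x \<le> y" "0 \<le> x" for x y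
      using mult_right_mono[OF s(1) that(2)] that(1) by simp
    note decr = scaled_row_decreases[where a = "\<lambda>i j. A $$ (i,j)" and n = n and d = d,
        OF nonneg diag two' d drop[OF upper] drop[OF lower], simplified]
    have dom: "s * (A $$ (i,j) * d j) \<le> A $$ (i,i) * d i"
      and dom': "?strict \<Longrightarrow> s * (A $$ (i,j) * d j) < A $$ (i,i) * d i"
      if ij: "i < n" "j < n" "i \<noteq> j" for i j
    proof -
      have "s * (A $$ (i,j) * d j) \<le> A $$ (i,i) * d i \<and>
          (?strict \<longrightarrow> s * (A $$ (i,j) * d j) < A $$ (i,i) * d i)"
      proof (cases "i < j")
        case True
        then have "s * (A $$ (i,j) * d j) \<le> s * (A $$ (i,Suc i) * d (Suc i))"
          using decr(1)[of i j] ij nonneg d s(1) by (intro mult_left_mono) (auto simp: less_imp_le)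
        then show ?thesis
          using upper[of i] upper'[of i] True ij by (meson le_less_trans less_trans_Suc order_trans)
      next
        case False
        then obtain k where k: "i = Suc k" "j \<le> k" using ij by (cases i) auto
        then have "s * (A $$ (i,j) * d j) \<le> s * (A $$ (Suc k,k) * d k)"
          using decr(2)[of j k] ij nonneg d s(1) by (intro mult_left_mono) (auto simp: less_imp_le)
        then show ?thesis
          using lower[of k] lower'[of k] k ij by (meson le_less_trans order_trans)
      qed
      then show "s * (A $$ (i,j) * d j) \<le> A $$ (i,i) * d i"
        and "?strict \<Longrightarrow> s * (A $$ (i,j) * d j) < A $$ (i,i) * d i" by auto
    qed
    let ?B = "mat n n (\<lambda>(i,j). A $$ (i,j) * d j)"
    have row: "(\<Sum>j\<in>{..<n} - {i}. \<bar>?B $$ (i,j)\<bar>) = (\<Sum>j\<in>{..<n} - {i}. A $$ (i,j) * d j)"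
      if "i < n" for i
      using that nonneg d by (intro sum.cong) (auto simp: abs_mult less_imp_le)
    have card: "of_nat (card ({..<n} - {i})) * x \<le> s * x" if "i < n" "0 \<le> x" for i and x :: 'a
    proof -
      have "of_nat (card ({..<n} - {i})) = (of_nat n - 1 :: 'a)" using that by (simp add: of_nat_diff)
      then show ?thesis using s(2) that(2) by (simp add: mult_right_mono)
    qed
    have s0: "0 < s" using s(1) by simp
    have "(\<Sum>j\<in>{..<n} - {i}. \<bar>?B $$ (i,j)\<bar>) \<le> ?B $$ (i,i)" if i: "i < n" for i
    proof -
      have "s * (\<Sum>j\<in>{..<n} - {i}. A $$ (i,j) * d j) = (\<Sum>j\<in>{..<n} - {i}. s * (A $$ (i,j) * d j))"
        by (rule sum_distrib_left)
      also have "\<dots> \<le> of_nat (card ({..<n} - {i})) * (A $$ (i,i) * d i)"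
        using dom i by (intro sum_bounded_above) auto
      also have "\<dots> \<le> s * (A $$ (i,i) * d i)"
        using i nonneg d[of i] by (intro card) auto
      finally show ?thesis using s0 i unfolding row[OF i] by simp
    qed
    moreover have "(\<Sum>j\<in>{..<n} - {i}. \<bar>?B $$ (i,j)\<bar>) < ?B $$ (i,i)" if i: "i < n" and ?strict for i
    proof (cases "{..<n} - {i} = {}")
      \<comment> \<open>For \<open>n = 1\<close> there is no off-diagonal entry to provide strictness; the diagonal does.\<close>
      case True
      then show ?thesis unfolding row[OF i] True using diag[OF i] d[of i] i by simp
    next
      case False
      have "s * (\<Sum>j\<in>{..<n} - {i}. A $$ (i,j) * d j) = (\<Sum>j\<in>{..<n} - {i}. s * (A $$ (i,j) * d j))"
        by (rule sum_distrib_left)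
      also have "\<dots> < of_nat (card ({..<n} - {i})) * (A $$ (i,i) * d i)"
        using dom' i \<open>?strict\<close> False by (intro sum_bounded_above_strict) (auto simp: card_gt_0_iff)
      also have "\<dots> \<le> s * (A $$ (i,i) * d i)"
        using i nonneg d[of i] by (intro card) auto
      finally show ?thesis using s0 i unfolding row[OF i] by simp
    qed
    ultimately have "0 \<le> det ?B \<and> (?strict \<longrightarrow> 0 < det ?B)"
      using det_diagonally_dominant[of ?B n] by auto
    moreover have "0 < (\<Prod>j<n. d j)" using d by (intro prod_pos) auto
    ultimately show ?thesis
      unfolding det_scale_columns[OF A] by (simp add: zero_le_mult_iff zero_less_mult_iff)
  qed
  show "0 \<le> det A"
  proof (cases "\<forall>i<n. 0 < A $$ (i,i)")
    case True
    then show ?thesis using main by blast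
  next
    case False
    then obtain i where "i < n" "A $$ (i,i) = 0" using nonneg by (meson not_less order_antisym)
    then have "det A = 0" using nonneg two' by (intro det_zero_diagonal[OF A]) auto
    then show ?thesis by simp
  qed
  show "0 < det A"
    if "\<And>i. i < n \<Longrightarrow> 0 < A $$ (i,i)"
      "\<And>i. Suc i < n \<Longrightarrow> C * A $$ (i,Suc i) * A $$ (Suc i,i) < A $$ (i,i) * A $$ (Suc i,Suc i)"
    using main that by blast
qed

lemma submatrix_entries:
  assumes I: "I \<subseteq> {..<dim_row A}" and J: "J \<subseteq> {..<dim_col A}"
  obtains r c where
    "submatrix A I J = mat (card I) (card J) (\<lambda>(i,j). A $$ (r i, c j))"
    "\<And>i. i < card I \<Longrightarrow> r i < dim_row A" "\<And>i i'. i < i' \<Longrightarrow> i' < card I \<Longrightarrow> r i < r i'"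
    "\<And>j. j < card J \<Longrightarrow> c j < dim_col A" "\<And>j j'. j < j' \<Longrightarrow> j' < card J \<Longrightarrow> c j < c j'"
proof
  have "{i. i < dim_row A \<and> i \<in> I} = I" "{j. j < dim_col A \<and> j \<in> J} = J" using I J by auto
  then show "submatrix A I J = mat (card I) (card J) (\<lambda>(i,j). A $$ (pick I i, pick J j))"
    by (simp add: submatrix_def)
qed (use pick_in_set_le pick_mono_le I J in \<open>auto simp: subset_iff\<close>)

theorem theorem3p5:
  fixes n m :: nat and C :: gpuiseux and A :: "gpuiseux mat"
  assumes "n \<ge> 1" and "m \<ge> 1"
    and "C \<ge> 1" and "C \<ge> (of_nat (min n m) - 1) ^ 2"
    and "A \<in> carrier_mat n m"
  shows "(A \<in> TN2 C \<longrightarrow> A \<in> TN) \<and> (A \<in> TP2 C \<longrightarrow> A \<in> TP)"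
proof -
  have dim: "dim_row A = n" "dim_col A = m" using assms(5) by auto
  have "(A \<in> TN2 C \<longrightarrow> 0 \<le> x) \<and> (A \<in> TP2 C \<longrightarrow> 0 < x)" if xA: "x \<in> minors A" for x
  proof -
    obtain I J where x: "x = det (submatrix A I J)" and I: "I \<subseteq> {..<n}" and J: "J \<subseteq> {..<m}"
      and IJ: "card I = card J" and "I \<noteq> {}"
      using xA unfolding minors_def dim by blast
    define k where "k = card I"
    have "finite I" using I finite_subset by blast
    then have k: "1 \<le> k" using \<open>I \<noteq> {}\<close> by (simp add: k_def Suc_le_eq card_gt_0_iff)
    have "k \<le> n" using card_mono[OF _ I] by (simp add: k_def)
    moreover have "k \<le> m" using card_mono[OF _ J] by (simp add: k_def IJ)
    ultimately have "(of_nat k :: gpuiseux) \<le> of_nat (min n m)"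
      by (subst of_nat_le_iff) simp
    moreover have "(1 :: gpuiseux) \<le> of_nat k" using k by simp
    ultimately have "(of_nat k - 1 :: gpuiseux)^2 \<le> (of_nat (min n m) - 1)^2"
      by (intro power_mono) auto
    then have C: "(of_nat k - 1)^2 \<le> C" using assms(4) by simp
    obtain r c where sub: "submatrix A I J = mat k k (\<lambda>(i,j). A $$ (r i, c j))"
      and r: "\<And>i. i < k \<Longrightarrow> r i < n" "\<And>i i'. i < i' \<Longrightarrow> i' < k \<Longrightarrow> r i < r i'"
      and c: "\<And>j. j < k \<Longrightarrow> c j < m" "\<And>j j'. j < j' \<Longrightarrow> j' < k \<Longrightarrow> c j < c j'"
      using submatrix_entries[of I A J] I J unfolding dim IJ[symmetric] k_def[symmetric] by blast
    let ?B = "mat k k (\<lambda>(i,j). A $$ (r i, c j))"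
    have B: "?B \<in> carrier_mat k k" by simp
    have "0 \<le> det ?B" if "A \<in> TN2 C"
      by (rule det_of_two_minors(1)[OF B _ _ assms(3) C])
        (use that r c in \<open>auto simp: TN2_def dim\<close>)
    moreover have "0 < det ?B" if "A \<in> TP2 C"
      by (rule det_of_two_minors(2)[OF B _ _ assms(3) C])
        (use that r c in \<open>auto simp: TP2_def dim less_imp_le Suc_lessD\<close>)
    ultimately show ?thesis unfolding x sub by blast
  qed
  then show ?thesis by (auto simp: TN_def TP_def)
qed

end
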